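(* Let $n\ge2$ be an integer and let $L,R,\varepsilon>0$ with $\varepsilon\le LR^2/4$. Then $$\mathfrak m_*^{\mathrm C}(\varepsilon,R,L,0)=\Omega\left(n+R\sqrt{nL/\varepsilon}\right).$$
   Context: Norms are Euclidean. $\mathcal P_{\mathcal X}$ is Euclidean projection onto a closed convex set $\mathcal X$. Problem: $\min_{x\in\mathcal X}f(x)=\frac1n\sum_{i=1}^nf_i(x)$ with $\mathcal X\subseteq\mathbb R^d$ closed and convex. A differentiable function is $L$-smooth if its gradient is $L$-Lipschitz. $f$ is $\mu$-strongly convex if $f-\frac\mu2\|\cdot\|^2$ is convex (for $\mu=0$: $f$ convex). PIFO algorithms. Fix an absolute constant $c_0>0$ (e.g. $c_0=2$). The oracle $h^{\mathrm{PIFO}}_{f_i}(x,\gamma)$, $\gamma>0$, returns $[f_i(x),\nabla f_i(x),\mathrm{prox}^\gamma_{f_i}(x)]$ with $\mathrm{prox}^\gamma_{f_i}(x)=\arg\min_{u\in\mathbb R^d}\{f_i(u)+\frac1{2\gamma}\|x-u\|^2\}$ (when $f_i$ is nonconvex, $\gamma$ must be such that the minimized function is convex in $u$). The oracle $h^{\mathrm{FO}}_f(x)$ returns $[f(x),\nabla f(x)]$. A PIFO algorithm $\mathcal A$ fixes a distribution $\mathcal D$ on $\{1,\dots,n\}$ and $0<q\le c_0/n$, starts at $x_0=0$ with $\mathcal H=\{x_0\}$, and at step $t=1,2,\dots$: (i) samples $i_t\sim\mathcal D$ and queries $h^{\mathrm{PIFO}}_{f_{i_t}}$; (ii) samples $a_t\sim\mathrm{Bernoulli}(q)$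 and, if $a_t=1$, queries $h^{\mathrm{FO}}_f$ and adds $x_{t-1}$ to $\mathcal H$; (iii) chooses $\tilde x_t$ in the linear span of $x_0,\dots,x_{t-1}$, of $\mathrm{prox}^{\gamma_j}_{f_{i_j}}(x_l)$ and $\nabla f_{i_j}(x_l)$ for $l<j\le t$, and of $\nabla f(u)$ for $u\in\mathcal H$; (iv) sets $x_t=\mathcal P_{\mathcal X}(\tilde x_t)$; (v) outputs $x_t$ or continues with $t+1$. The pairs $(i_t,a_t)$, $t\ge1$, are mutually independent and $i_t$ is independent of $a_t$. $\mathscr A$ is the class of all PIFO algorithms. Complexity. $\mathcal F^*_{\mathrm C}(R,L,\mu)$ is the set of $f=\frac1n\sum_{i=1}^nf_i:\mathcal X\to\mathbb R$ (any dimension $d$) with $\mathrm{diam}(\mathcal X)\le2R$, each $f_i$ $L$-smooth and $f$ $\mu$-strongly convex. $T(\mathcal A,f,\varepsilon)=\inf\{T\in\mathbb N:\mathbb Ef(x_{\mathcal A,T})-\min_{x\in\mathcal X}f(x)<\varepsilon\}$, where $x_{\mathcal A,T}$ is the point obtained by $\mathcal A$ at time-step $T$. $\mathfrak m^{\mathrm C}_*(\varepsilon,R,L,\mu)=\inf_{\mathcal A\in\mathscr A}\sup_{f\in\mathcal F^*_{\mathrm C}(R,L,\mu)}T(\mathcal A,f,\varepsilon)$; here $\mu=0$. $\Omega(g)$ means at least $c\,g$ with an absolute constant $c>0$ not depending on any problem parameter ($c_0$ being a fixed constant). *)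

theory Defs
  imports "HOL-Probability.Probability"
begin

(* The dimension d of a problem is quantified inside the supremum of the complexity, so R^d
   cannot be a type here.  All R^d live in one real inner product space, the finitely supported
   real sequences; R^d is the subspace (eucl d) of the sequences that vanish from index d on,
   with the Euclidean norm and inner product. *)

typedef fseq = "{x :: nat \<Rightarrow> real. finite {i. x i \<noteq> 0}}"
  morphisms coord Abs_fseq
  by (rule exI[of _ "\<lambda>_. 0"]) simp

setup_lifting type_definition_fseq

lemma finite_support [simp]: "finite {i. coord x i \<noteq> 0}"
  using coord[of x] by simp

lemma fseq_eqI: "(\<And>i. coord x i = coord y i) \<Longrightarrow> x = y"
  by (simp add: coord_inject[symmetric] fun_eq_iff)

instantiation fseq :: real_vector
begin

lift_definition zero_fseq :: fseq is "\<lambda>_. 0" by simp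

lift_definition plus_fseq :: "fseq \<Rightarrow> fseq \<Rightarrow> fseq" is "\<lambda>x y i. x i + y i"
  subgoal for x y
    by (rule finite_subset[of _ "{i. x i \<noteq> 0} \<union> {i. y i \<noteq> 0}"]) auto
  done

lift_definition uminus_fseq :: "fseq \<Rightarrow> fseq" is "\<lambda>x i. - x i" by simp

lift_definition minus_fseq :: "fseq \<Rightarrow> fseq \<Rightarrow> fseq" is "\<lambda>x y i. x i - y i"
  subgoal for x y
    by (rule finite_subset[of _ "{i. x i \<noteq> 0} \<union> {i. y i \<noteq> 0}"]) auto
  done

lift_definition scaleR_fseq :: "real \<Rightarrow> fseq \<Rightarrow> fseq" is "\<lambda>c x i. c * x i"
  subgoal for c x
    by (rule finite_subset[of _ "{i. x i \<noteq> 0}"]) auto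
  done

instance
  by standard (transfer, simp add: fun_eq_iff algebra_simps)+

end

lemma coord_simps [simp]:
  "coord 0 i = 0"
  "coord (x + y) i = coord x i + coord y i"
  "coord (- x) i = - coord x i"
  "coord (x - y) i = coord x i - coord y i"
  "coord (c *\<^sub>R x) i = c * coord x i"
  by (transfer, simp)+

instantiation fseq :: real_inner
begin

definition inner_fseq :: "fseq \<Rightarrow> fseq \<Rightarrow> real" where
  "inner_fseq x y = (\<Sum>i | coord x i \<noteq> 0. coord x i * coord y i)"

definition norm_fseq :: "fseq \<Rightarrow> real" where
  "norm_fseq x = sqrt (inner x x)"

definition sgn_fseq :: "fseq \<Rightarrow> fseq" where
  "sgn_fseq x = x /\<^sub>R norm x"

definition dist_fseq :: "fseq \<Rightarrow> fseq \<Rightarrow> real" where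
  "dist_fseq x y = norm (x - y)"

definition uniformity_fseq :: "(fseq \<times> fseq) filter" where
  "uniformity_fseq = (INF e\<in>{0<..}. principal {(x, y). dist x y < e})"

definition open_fseq :: "fseq set \<Rightarrow> bool" where
  "open_fseq U \<longleftrightarrow> (\<forall>x\<in>U. eventually (\<lambda>(x', y). x' = x \<longrightarrow> y \<in> U) uniformity)"

lemma inner_fseq_superset:
  assumes "finite S" "{i. coord x i \<noteq> 0} \<subseteq> S"
  shows "inner x y = (\<Sum>i\<in>S. coord x i * coord y i)"
  unfolding inner_fseq_def using assms by (intro sum.mono_neutral_left) auto

instance
proof
  fix x y z :: fseq and r :: real
  let ?S = "{i. coord x i \<noteq> 0} \<union> {i. coord y i \<noteq> 0}"
  have S: "finite ?S" by simp
  have "inner x y = (\<Sum>i\<in>?S. coord x i * coord y i)"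
    by (rule inner_fseq_superset) auto
  also have "\<dots> = (\<Sum>i\<in>?S. coord y i * coord x i)"
    by (simp add: mult.commute)
  also have "\<dots> = inner y x"
    by (rule inner_fseq_superset[symmetric]) auto
  finally show "inner x y = inner y x" .
  have "inner (x + y) z = (\<Sum>i\<in>?S. coord (x + y) i * coord z i)"
    by (rule inner_fseq_superset[OF S]) auto
  also have "\<dots> = (\<Sum>i\<in>?S. coord x i * coord z i) + (\<Sum>i\<in>?S. coord y i * coord z i)"
    by (simp only: coord_simps distrib_right sum.distrib)
  also have "\<dots> = inner x z + inner y z"
    using inner_fseq_superset[OF S, of x z] inner_fseq_superset[OF S, of y z] by simp
  finally show "inner (x + y) z = inner x z + inner y z" .
  have "inner (r *\<^sub>R x) y = (\<Sum>i\<in>?S. coord (r *\<^sub>R x) i * coord y i)"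
    by (rule inner_fseq_superset[OF S]) auto
  also have "\<dots> = r * (\<Sum>i\<in>?S. coord x i * coord y i)"
    by (simp only: coord_simps sum_distrib_left mult.assoc)
  also have "\<dots> = r * inner x y"
    using inner_fseq_superset[OF S, of x y] by simp
  finally show "inner (r *\<^sub>R x) y = r * inner x y" .
  show "0 \<le> inner x x"
    unfolding inner_fseq_def by (rule sum_nonneg) simp
  have "inner x x = 0 \<longleftrightarrow> (\<forall>i\<in>{i. coord x i \<noteq> 0}. coord x i * coord x i = 0)"
    unfolding inner_fseq_def by (rule sum_nonneg_eq_0_iff) auto
  then show "inner x x = 0 \<longleftrightarrow> x = 0"
    by (auto simp: coord_inject[symmetric] fun_eq_iff)
  show "norm x = sqrt (inner x x)" by (rule norm_fseq_def)
  show "sgn x = x /\<^sub>R norm x" by (rule sgn_fseq_def)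
  show "dist x y = norm (x - y)" by (rule dist_fseq_def)
qed (rule uniformity_fseq_def open_fseq_def)+

end

definition eucl :: "nat \<Rightarrow> fseq set" where
  "eucl d = {x. \<forall>i\<ge>d. coord x i = 0}"

lemma subspace_eucl: "subspace (eucl d)"
  by (auto simp: eucl_def subspace_def)

lemma inner_eucl: "x \<in> eucl d \<Longrightarrow> inner x y = (\<Sum>i<d. coord x i * coord y i)"
  by (rule inner_fseq_superset) (auto simp: eucl_def not_le[symmetric])

definition is_grad :: "nat \<Rightarrow> (fseq \<Rightarrow> real) \<Rightarrow> fseq \<Rightarrow> fseq \<Rightarrow> bool" where
  "is_grad d f x g \<longleftrightarrow>
     g \<in> eucl d \<and> (f has_derivative (\<lambda>h. inner g h)) (at x within eucl d)"

definition grad :: "nat \<Rightarrow> (fseq \<Rightarrow> real) \<Rightarrow> fseq \<Rightarrow> fseq" where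
  "grad d f x = (THE g. is_grad d f x g)"

definition smooth :: "nat \<Rightarrow> real \<Rightarrow> (fseq \<Rightarrow> real) \<Rightarrow> bool" where
  "smooth d L f \<longleftrightarrow> f differentiable_on eucl d \<and> L-lipschitz_on (eucl d) (grad d f)"

definition strongly_convex :: "nat \<Rightarrow> real \<Rightarrow> (fseq \<Rightarrow> real) \<Rightarrow> bool" where
  "strongly_convex d \<mu> f \<longleftrightarrow> convex_on (eucl d) (\<lambda>x. f x - \<mu> / 2 * (norm x)\<^sup>2)"

definition prox_objective :: "real \<Rightarrow> (fseq \<Rightarrow> real) \<Rightarrow> fseq \<Rightarrow> fseq \<Rightarrow> real" where
  "prox_objective \<gamma> f x u = f u + 1 / (2 * \<gamma>) * (norm (x - u))\<^sup>2"

(* The arg min is kept as a set.  It is a singleton when the objective is strongly convex; a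
   merely convex objective may have no minimiser or several, and then no junk value is made up. *)
definition prox :: "nat \<Rightarrow> real \<Rightarrow> (fseq \<Rightarrow> real) \<Rightarrow> fseq \<Rightarrow> fseq set" where
  "prox d \<gamma> f x = {p. is_arg_min (prox_objective \<gamma> f x) (\<lambda>u. u \<in> eucl d) p}"

definition prox_admissible :: "nat \<Rightarrow> real \<Rightarrow> (fseq \<Rightarrow> real) \<Rightarrow> bool" where
  "prox_admissible d \<gamma> f \<longleftrightarrow>
     \<gamma> > 0 \<and> (\<forall>x\<in>eucl d. convex_on (eucl d) (prox_objective \<gamma> f x))"

(* closest_point of the library is restricted to Heine-Borel types, which fseq is not. *)
definition proj :: "fseq set \<Rightarrow> fseq \<Rightarrow> fseq" where
  "proj X x = arg_min_on (dist x) X"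

(* comp I i is the i-th component f_i for i in {1..n}; the number n of components is a separate
   parameter.  The components are functions on all of R^d, since they are evaluated at x_0 = 0
   and inside proximal operators, and neither has to stay in the feasible set. *)
record problem =
  dim :: nat
  feas :: "fseq set"
  comp :: "nat \<Rightarrow> fseq \<Rightarrow> real"

definition objective :: "nat \<Rightarrow> problem \<Rightarrow> fseq \<Rightarrow> real" where
  "objective n I x = 1 / real n * (\<Sum>i = 1..n. comp I i x)"

definition smooth_problem :: "nat \<Rightarrow> problem \<Rightarrow> bool" where
  "smooth_problem n I \<longleftrightarrow>
     feas I \<subseteq> eucl (dim I) \<and> feas I \<noteq> {} \<and> closed (feas I) \<and> convex (feas I) \<and>
     (\<forall>i\<in>{1..n}. \<exists>L. smooth (dim I) L (comp I i))"

(* The boundedness condition is needed because diameter is unspecified on unbounded sets. *)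
definition problem_class :: "nat \<Rightarrow> real \<Rightarrow> real \<Rightarrow> real \<Rightarrow> problem set" where
  "problem_class n R L \<mu> = {I. smooth_problem n I \<and>
     bounded (feas I) \<and> diameter (feas I) \<le> 2 * R \<and>
     (\<forall>i\<in>{1..n}. smooth (dim I) L (comp I i)) \<and>
     strongly_convex (dim I) \<mu> (objective n I)}"

(* A history is the list [(i_1,a_1),...,(i_t,a_t)] of the samples drawn in steps 1 to t.  The
   sampling distribution and the probability of a full gradient query are fixed by the
   algorithm, independently of the problem.  The choices in step t, namely the proximal
   parameter gamma_t (stepsize) and the point before projection (choice), are functions of the
   problem, of the history up to step t, and of a random seed that is drawn independently of
   all samples, so that randomised choices are included. *)
record pifo =
  sampling :: "nat pmf"
  full_prob :: real
  seed :: "real measure"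
  stepsize :: "problem \<Rightarrow> real \<Rightarrow> (nat \<times> bool) list \<Rightarrow> real"
  choice :: "problem \<Rightarrow> real \<Rightarrow> (nat \<times> bool) list \<Rightarrow> fseq"

definition iterate :: "pifo \<Rightarrow> problem \<Rightarrow> real \<Rightarrow> (nat \<times> bool) list \<Rightarrow> fseq" where
  "iterate A I \<omega> h = (if h = [] then 0 else proj (feas I) (choice A I \<omega> h))"

(* The points x such that the full gradient at x is available after the history h. *)
definition full_queries :: "pifo \<Rightarrow> problem \<Rightarrow> real \<Rightarrow> (nat \<times> bool) list \<Rightarrow> fseq set" where
  "full_queries A I \<omega> h =
     insert (iterate A I \<omega> [])
       {iterate A I \<omega> (take (j - 1) h) | j. j \<in> {1..length h} \<and> snd (h ! (j - 1))}"

definition pifo_span :: "nat \<Rightarrow> pifo \<Rightarrow> problem \<Rightarrow> real \<Rightarrow> (nat \<times> bool) list \<Rightarrow> fseq set" where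
  "pifo_span n A I \<omega> h =
     (let d = dim I; t = length h;
          x = (\<lambda>l. iterate A I \<omega> (take l h));
          \<gamma> = (\<lambda>j. stepsize A I \<omega> (take j h));
          F = (\<lambda>j. comp I (fst (h ! (j - 1))))
      in span
           ({x l | l. l < t} \<union>
            {p. \<exists>l j. l < j \<and> j \<le> t \<and> p \<in> prox d (\<gamma> j) (F j) (x l)} \<union>
            {grad d (F j) (x l) | l j. l < j \<and> j \<le> t} \<union>
            {grad d (objective n I) u | u. u \<in> full_queries A I \<omega> h}))"

definition pifo_algorithm :: "real \<Rightarrow> nat \<Rightarrow> pifo \<Rightarrow> bool" where
  "pifo_algorithm c0 n A \<longleftrightarrow>
     set_pmf (sampling A) \<subseteq> {1..n} \<and>
     0 < full_prob A \<and> full_prob A \<le> c0 / real n \<and> full_prob A \<le> 1 \<and>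
     prob_space (seed A) \<and> sets (seed A) = sets borel \<and>
     (\<forall>I h. smooth_problem n I \<and> h \<noteq> [] \<and> set h \<subseteq> {1..n} \<times> UNIV \<longrightarrow>
        (\<lambda>\<omega>. choice A I \<omega> h) \<in> borel_measurable (seed A) \<and>
        (\<forall>\<omega>. prox_admissible (dim I) (stepsize A I \<omega> h) (comp I (fst (last h))) \<and>
             choice A I \<omega> h \<in> pifo_span n A I \<omega> h))"

definition history_pmf :: "pifo \<Rightarrow> nat \<Rightarrow> (nat \<times> bool) list pmf" where
  "history_pmf A t =
     replicate_pmf t (pair_pmf (sampling A) (bernoulli_pmf (full_prob A)))"

definition expected_value :: "nat \<Rightarrow> pifo \<Rightarrow> problem \<Rightarrow> nat \<Rightarrow> real" where
  "expected_value n A I t =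
     (\<integral>\<omega>. measure_pmf.expectation (history_pmf A t)
             (\<lambda>h. objective n I (iterate A I \<omega> h)) \<partial>seed A)"

(* On problem_class the feasible set is compact and nonempty, so the infimum is the minimum.
   The value is infinity if the accuracy is never reached. *)
definition complexity :: "nat \<Rightarrow> pifo \<Rightarrow> problem \<Rightarrow> real \<Rightarrow> enat" where
  "complexity n A I \<epsilon> =
     Inf {enat T | T. expected_value n A I T - (INF x\<in>feas I. objective n I x) < \<epsilon>}"

definition minimax_complexity :: "real \<Rightarrow> nat \<Rightarrow> real \<Rightarrow> real \<Rightarrow> real \<Rightarrow> real \<Rightarrow> enat" where
  "minimax_complexity c0 n \<epsilon> R L \<mu> =
     (INF A\<in>{A. pifo_algorithm c0 n A}. SUP I\<in>problem_class n R L \<mu>. complexity n A I \<epsilon>)"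

end

theory Submission
  imports Defs
begin

text \<open>
The bound comes from one family of chain functions. Put \<open>\<lambda> = L / (4 n)\<close> and let the
objective be \<open>f(x) = \<lambda> (\<Sum>l<K. (x_l - x_{l+1})^2) - b x_0\<close> on the box
\<open>X = {M} \<times> [0, r]^K\<close> with \<open>r = 2 R / sqrt K\<close>, whose diameter is \<open>2 R\<close>. The edges
\<open>(l, l+1)\<close> are dealt out alternately to two components \<open>i0\<close> and \<open>i1\<close>; the
edges of one component are disjoint, so weight \<open>L / 4\<close> per edge makes it \<open>L\<close>-smooth.
An algorithm whose points so far vanish from coordinate \<open>k \<ge> 1\<close> on can reach coordinate \<open>k\<close>
only by sampling the owner of the edge \<open>(k-1, k)\<close> or by a full gradient query
(lemma \<open>iterate_in_eucl_level\<close>). Whatever the sampling distribution, two components of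
probability at most \<open>2 / n\<close> exist, and with these as \<open>i0\<close> and \<open>i1\<close> each step
advances with probability at most \<open>(2 + c0) / n\<close>. Hence after \<open>T\<close> steps the expected
number of nonzero coordinates is at most \<open>1 + T (2 + c0) / n\<close>.

While at most \<open>K\<close> coordinates are reached, the Cauchy-Schwarz inequality gives
\<open>f \<ge> \<lambda> M^2 / K - b M\<close>, which is \<open>0 = f(0)\<close> for \<open>b = \<lambda> M / K\<close>; the corner
\<open>(M, r, ..., r)\<close> shows that the minimum is at most
\<open>- \<lambda> (M^2 / K - (M - r)^2)\<close>. If this is at most \<open>- 2 \<epsilon>\<close>, a Markov-type
argument shows that accuracy \<open>\<epsilon>\<close> is not reached before step \<open>n K / (2 (2 + c0))\<close>
(lemmas \<open>expected_value_ge\<close> and \<open>minimax_complexity_ge\<close>).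

The box need not contain the starting point \<open>0\<close>, so \<open>M\<close> is free. For \<open>K = 1\<close> the gap
\<open>\<lambda> (4 M R - 4 R^2)\<close> grows without bound in \<open>M\<close>, which gives the term \<open>n\<close>.
For larger \<open>K\<close> the choice \<open>M = r (1 + 1 / K)\<close> gives a gap of at least
\<open>\<lambda> r^2 / K = L R^2 / (n K^2)\<close>, so \<open>K\<close> may be of order
\<open>R sqrt (L / (n \<epsilon>))\<close>, which gives the term \<open>R sqrt (n L / \<epsilon>)\<close>.
\<close>

section \<open>Finitely supported sequences\<close>

lift_definition unit_vec :: "nat \<Rightarrow> fseq" is "\<lambda>i j. if j = i then 1 else 0"
  by simp

lift_definition trunc :: "nat \<Rightarrow> fseq \<Rightarrow> fseq" is "\<lambda>k x i. if i < k then x i else 0"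
  subgoal for k x by (rule finite_subset[of _ "{i. x i \<noteq> 0}"]) auto
  done

lemma coord_unit_vec [simp]: "coord (unit_vec i) j = (if j = i then 1 else 0)"
  by transfer simp

lemma coord_trunc [simp]: "coord (trunc k x) i = (if i < k then coord x i else 0)"
  by transfer simp

lemma inner_unit_vec [simp]: "inner (unit_vec i) x = coord x i"
proof -
  have "inner (unit_vec i) x = (\<Sum>j\<in>{i}. coord (unit_vec i) j * coord x j)"
    by (rule inner_fseq_superset) auto
  then show ?thesis by simp
qed

lemma norm_sq_superset:
  assumes "finite S" "{i. coord x i \<noteq> 0} \<subseteq> S"
  shows "(norm x)\<^sup>2 = (\<Sum>i\<in>S. (coord x i)\<^sup>2)"
  unfolding power2_norm_eq_inner unfolding power2_eq_square by (rule inner_fseq_superset[OF assms])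

lemma norm_le_coordwise:
  assumes "\<And>i. \<bar>coord u i\<bar> \<le> \<bar>coord v i\<bar>"
  shows "norm u \<le> norm v"
proof -
  let ?S = "{i. coord v i \<noteq> 0}"
  have sub: "{i. coord u i \<noteq> 0} \<subseteq> ?S"
  proof
    fix i assume "i \<in> {i. coord u i \<noteq> 0}"
    then show "i \<in> ?S" using assms[of i] by auto
  qed
  have "(norm u)\<^sup>2 = (\<Sum>i\<in>?S. (coord u i)\<^sup>2)" by (rule norm_sq_superset) (use sub in auto)
  also have "\<dots> \<le> (\<Sum>i\<in>?S. (coord v i)\<^sup>2)"
    by (intro sum_mono) (use assms in \<open>simp add: abs_le_square_iff\<close>)
  also have "\<dots> = (norm v)\<^sup>2" by (rule norm_sq_superset[symmetric]) auto
  finally show ?thesis by simp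
qed

text \<open>Cutting off coordinates that a point of \<open>eucl k\<close> does not have brings one strictly
closer to it. This is what keeps minimisers of proximal and projection type inside \<open>eucl k\<close>.\<close>

lemma norm_trunc_less:
  assumes "x \<in> eucl k" "p \<notin> eucl k"
  shows "norm (x - trunc k p) < norm (x - p)"
proof -
  obtain j where j: "j \<ge> k" "coord p j \<noteq> 0" using assms by (auto simp: eucl_def)
  have x0: "coord x i = 0" if "i \<ge> k" for i using assms that by (auto simp: eucl_def)
  let ?S = "{i. coord (x - p) i \<noteq> 0}"
  have fin: "finite ?S" by (rule finite_support)
  have "(norm (x - trunc k p))\<^sup>2 = (\<Sum>i\<in>?S. (coord (x - trunc k p) i)\<^sup>2)"
    by (rule norm_sq_superset[OF fin]) (use x0 in \<open>auto split: if_splits simp: not_less\<close>)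
  also have "\<dots> < (\<Sum>i\<in>?S. (coord (x - p) i)\<^sup>2)"
  proof (rule sum_strict_mono_ex1)
    show "\<forall>i\<in>?S. (coord (x - trunc k p) i)\<^sup>2 \<le> (coord (x - p) i)\<^sup>2" using x0 by auto
    show "\<exists>i\<in>?S. (coord (x - trunc k p) i)\<^sup>2 < (coord (x - p) i)\<^sup>2"
      using j x0[of j] by (intro bexI[of _ j]) auto
  qed (rule fin)
  also have "\<dots> = (norm (x - p))\<^sup>2" by (rule norm_sq_superset[OF fin order.refl, symmetric])
  finally show ?thesis by (rule power_less_imp_less_base) simp
qed

lemma eucl_mono: "j \<le> k \<Longrightarrow> eucl j \<subseteq> eucl k"
  by (auto simp: eucl_def)

lemma trunc_in_eucl: "p \<in> eucl d \<Longrightarrow> trunc k p \<in> eucl d"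
  by (auto simp: eucl_def)

text \<open>Truncation does not increase \<open>f\<close> and strictly decreases the quadratic term unless it leaves
the point unchanged, so it fixes every minimiser.\<close>

lemma prox_in_eucl:
  assumes "\<gamma> > 0" "x \<in> eucl k" "p \<in> prox d \<gamma> f x" "f (trunc k p) \<le> f p"
  shows "p \<in> eucl k"
proof (rule ccontr)
  assume "p \<notin> eucl k"
  then have "(norm (x - trunc k p))\<^sup>2 < (norm (x - p))\<^sup>2"
    using norm_trunc_less[OF assms(2)] by (simp add: power_strict_mono)
  then have "1 / (2 * \<gamma>) * (norm (x - trunc k p))\<^sup>2 < 1 / (2 * \<gamma>) * (norm (x - p))\<^sup>2"
    using assms(1) by (intro mult_strict_left_mono) auto
  then have "prox_objective \<gamma> f x (trunc k p) < prox_objective \<gamma> f x p"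
    using assms(4) by (simp add: prox_objective_def)
  moreover have "trunc k p \<in> eucl d" "\<not> (\<exists>u. u \<in> eucl d \<and> prox_objective \<gamma> f x u < prox_objective \<gamma> f x p)"
    using assms(3) by (auto simp: prox_def is_arg_min_def intro: trunc_in_eucl)
  ultimately show False by blast
qed

lemma is_arg_min_proj:
  assumes "is_arg_min (dist x) (\<lambda>u. u \<in> X) p"
  shows "is_arg_min (dist x) (\<lambda>u. u \<in> X) (proj X x)"
  using assms unfolding proj_def arg_min_on_def arg_min_def by (rule someI)

section \<open>Gradients\<close>

text \<open>The derivative is taken within a proper subspace, so it determines the gradient only because
the gradient itself is required to lie there: the difference of two candidates is an admissible
direction, and the derivative along it is its squared norm.\<close>

lemma is_grad_unique:
  assumes "x \<in> eucl d" "is_grad d f x g" "is_grad d f x g'"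
  shows "g = g'"
proof -
  let ?h = "g - g'"
  have h: "?h \<in> eucl d"
    using assms subspace_diff[OF subspace_eucl] by (auto simp: is_grad_def)
  let ?c = "\<lambda>t::real. x + t *\<^sub>R ?h"
  have c: "range ?c \<subseteq> eucl d"
    using assms(1) h subspace_eucl by (auto intro: subspace_add subspace_scale)
  have D: "((\<lambda>t. f (?c t)) has_derivative (\<lambda>t. inner a (t *\<^sub>R ?h))) (at 0)"
    if "is_grad d f x a" for a
  proof -
    have "(f has_derivative (\<lambda>h. inner a h)) (at (?c 0) within range ?c)"
      using that c by (auto simp: is_grad_def intro: has_derivative_subset)
    moreover have "(?c has_derivative (\<lambda>t. t *\<^sub>R ?h)) (at 0)"
      by (auto intro!: derivative_eq_intros)
    ultimately show ?thesis
      using has_derivative_in_compose[of ?c "\<lambda>t. t *\<^sub>R ?h" 0 UNIV f "\<lambda>h. inner a h"] by simp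
  qed
  have "(\<lambda>t::real. inner g (t *\<^sub>R ?h)) = (\<lambda>t. inner g' (t *\<^sub>R ?h))"
    by (rule has_derivative_unique[OF D D]) (rule assms)+
  then have "inner g (1 *\<^sub>R ?h) = inner g' (1 *\<^sub>R ?h)" by metis
  then have "inner ?h ?h = 0" by (simp add: inner_diff_left)
  then show ?thesis by simp
qed

lemma grad_eq: "x \<in> eucl d \<Longrightarrow> is_grad d f x g \<Longrightarrow> grad d f x = g"
  unfolding grad_def using is_grad_unique by blast

section \<open>Quadratic chains\<close>

definition edge :: "nat \<Rightarrow> fseq" where
  "edge l = unit_vec l - unit_vec (Suc l)"

definition chain :: "real \<Rightarrow> real \<Rightarrow> nat set \<Rightarrow> fseq \<Rightarrow> real" where
  "chain \<alpha> b S x = \<alpha> * (\<Sum>l\<in>S. (inner (edge l) x)\<^sup>2) - b * coord x 0"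

definition chain_grad :: "real \<Rightarrow> real \<Rightarrow> nat set \<Rightarrow> fseq \<Rightarrow> fseq" where
  "chain_grad \<alpha> b S x = (\<Sum>l\<in>S. (2 * \<alpha> * inner (edge l) x) *\<^sub>R edge l) - b *\<^sub>R unit_vec 0"

lemma inner_edge: "inner (edge l) x = coord x l - coord x (Suc l)"
  by (simp add: edge_def inner_diff_left)

lemma edge_in_eucl: "Suc l < k \<Longrightarrow> edge l \<in> eucl k"
  by (auto simp: edge_def eucl_def)

lemma is_grad_chain:
  assumes "S \<subseteq> {..<K}"
  shows "is_grad (Suc K) (chain \<alpha> b S) x (chain_grad \<alpha> b S x)"
proof -
  have "(\<Sum>l\<in>S. (2 * \<alpha> * inner (edge l) x) *\<^sub>R edge l) \<in> eucl (Suc K)"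
    using assms by (intro subspace_sum[OF subspace_eucl] subspace_scale[OF subspace_eucl] edge_in_eucl) auto
  moreover have "b *\<^sub>R unit_vec 0 \<in> eucl (Suc K)"
    by (auto simp: eucl_def)
  ultimately have "chain_grad \<alpha> b S x \<in> eucl (Suc K)"
    unfolding chain_grad_def by (intro subspace_diff[OF subspace_eucl])
  moreover have "(chain \<alpha> b S has_derivative (\<lambda>h. inner (chain_grad \<alpha> b S x) h)) (at x within eucl (Suc K))"
  proof -
    have eq: "chain \<alpha> b S = (\<lambda>x. \<alpha> * (\<Sum>l\<in>S. (inner (edge l) x)\<^sup>2) - b * inner (unit_vec 0) x)"
      by (simp add: chain_def fun_eq_iff)
    show ?thesis
      unfolding eq chain_grad_def
      by (auto intro!: derivative_eq_intros ext
          simp: inner_diff_left inner_sum_left sum_distrib_left mult_ac simp del: inner_unit_vec)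
  qed
  ultimately show ?thesis by (simp add: is_grad_def)
qed

lemma grad_chain:
  assumes "S \<subseteq> {..<K}" "x \<in> eucl (Suc K)"
  shows "grad (Suc K) (chain \<alpha> b S) x = chain_grad \<alpha> b S x"
  using grad_eq is_grad_chain assms by blast

text \<open>The vectors \<open>edge l\<close> with \<open>l \<in> S\<close> are orthogonal of squared length 2, so
\<open>A w = (\<Sum>l\<in>S. \<langle>edge l, w\<rangle> edge l)\<close> satisfies \<open>\<langle>A w, A w\<rangle> = 2 \<langle>A w, w\<rangle>\<close>, and
the Cauchy-Schwarz inequality finishes.\<close>

lemma edge_map_norm_le:
  assumes "finite S" "\<And>l. l \<in> S \<Longrightarrow> Suc l \<notin> S"
  shows "norm (\<Sum>l\<in>S. inner (edge l) w *\<^sub>R edge l) \<le> 2 * norm w"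
proof -
  let ?A = "\<Sum>l\<in>S. inner (edge l) w *\<^sub>R edge l"
  have orth: "inner (edge l) (edge l') = (if l' = l then 2 else 0)" if "l \<in> S" "l' \<in> S" for l l'
    using assms(2)[of l] assms(2)[of l'] that by (auto simp: inner_edge) (auto simp: edge_def)
  have A: "inner (edge l) ?A = 2 * inner (edge l) w" if "l \<in> S" for l
  proof -
    have "inner (edge l) ?A = (\<Sum>l'\<in>S. if l' = l then 2 * inner (edge l) w else 0)"
      unfolding inner_sum_right using that by (intro sum.cong) (auto simp: orth)
    then show ?thesis using that assms(1) by simp
  qed
  have "(norm ?A)\<^sup>2 = (\<Sum>l\<in>S. inner (edge l) w * inner (edge l) ?A)"
    unfolding power2_norm_eq_inner by (subst inner_sum_left) simp
  also have "\<dots> = 2 * inner ?A w"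
    using A by (simp add: inner_sum_left sum_distrib_left mult_ac)
  also have "\<dots> \<le> 2 * (norm ?A * norm w)"
    using norm_cauchy_schwarz by simp
  finally have "norm ?A * norm ?A \<le> norm ?A * (2 * norm w)"
    by (simp add: power2_eq_square)
  then show ?thesis by (cases "?A = 0") auto
qed

lemma smooth_chain:
  assumes "S \<subseteq> {..<K}" "\<And>l. l \<in> S \<Longrightarrow> Suc l \<notin> S" "L > 0"
  shows "smooth (Suc K) L (chain (L / 4) b S)"
  unfolding smooth_def
proof
  show "chain (L / 4) b S differentiable_on eucl (Suc K)"
    using is_grad_chain[OF assms(1)]
    by (auto simp: differentiable_on_def differentiable_def is_grad_def)
  have fin: "finite S" using assms(1) finite_subset by blast
  show "L-lipschitz_on (eucl (Suc K)) (grad (Suc K) (chain (L / 4) b S))"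
  proof (rule lipschitz_onI)
    fix x y assume xy: "x \<in> eucl (Suc K)" "y \<in> eucl (Suc K)"
    have "chain_grad (L / 4) b S x - chain_grad (L / 4) b S y
        = (L / 2) *\<^sub>R (\<Sum>l\<in>S. inner (edge l) (x - y) *\<^sub>R edge l)"
      by (simp add: chain_grad_def scaleR_sum_right sum_subtractf[symmetric] inner_diff_right
          scaleR_diff_left algebra_simps)
    then have "dist (chain_grad (L / 4) b S x) (chain_grad (L / 4) b S y)
        = (L / 2) * norm (\<Sum>l\<in>S. inner (edge l) (x - y) *\<^sub>R edge l)"
      using assms(3) by (simp add: dist_norm)
    also have "\<dots> \<le> (L / 2) * (2 * norm (x - y))"
      using assms by (intro mult_left_mono edge_map_norm_le fin) auto
    finally show "dist (grad (Suc K) (chain (L / 4) b S) x) (grad (Suc K) (chain (L / 4) b S) y) \<le> L * dist x y"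
      using xy assms(1) by (simp add: grad_chain dist_norm)
  qed (use assms in simp)
qed

text \<open>Without the edge joining coordinates \<open>k - 1\<close> and \<open>k\<close>, the chain splits at \<open>k\<close>
into two parts in disjoint variables. Neither a gradient step nor (by the next lemma) a proximal step
carries information across the split.\<close>

lemma chain_grad_in_eucl:
  assumes "x \<in> eucl k" "k \<ge> 1" "k - 1 \<notin> S"
  shows "chain_grad \<alpha> b S x \<in> eucl k"
proof -
  have "(2 * \<alpha> * inner (edge l) x) *\<^sub>R edge l \<in> eucl k" if "l \<in> S" for l
  proof (cases "Suc l < k")
    case True
    then show ?thesis by (intro subspace_scale[OF subspace_eucl] edge_in_eucl)
  next
    case False
    then have "k \<le> l" using assms that by (cases "l = k - 1") auto
    then show ?thesis using assms(1) by (simp add: inner_edge eucl_def)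
  qed
  moreover have "b *\<^sub>R unit_vec 0 \<in> eucl k" using assms(2) by (auto simp: eucl_def)
  ultimately show ?thesis
    unfolding chain_grad_def by (intro subspace_diff subspace_sum subspace_eucl) auto
qed

lemma chain_trunc_le:
  assumes "k \<ge> 1" "k - 1 \<notin> S" "\<alpha> \<ge> 0"
  shows "chain \<alpha> b S (trunc k p) \<le> chain \<alpha> b S p"
proof -
  have "(\<Sum>l\<in>S. (inner (edge l) (trunc k p))\<^sup>2) \<le> (\<Sum>l\<in>S. (inner (edge l) p)\<^sup>2)"
  proof (rule sum_mono)
    fix l assume "l \<in> S"
    then have "l \<noteq> k - 1" using assms(2) by metis
    then consider "Suc l < k" | "k \<le> l" by linarith
    then show "(inner (edge l) (trunc k p))\<^sup>2 \<le> (inner (edge l) p)\<^sup>2"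
      by cases (auto simp: inner_edge)
  qed
  then show ?thesis using assms by (auto simp: chain_def intro: mult_left_mono)
qed

lemma convex_chain:
  assumes "\<alpha> \<ge> 0" "convex T"
  shows "convex_on T (chain \<alpha> b S)"
proof -
  have lin: "convex_on T (\<lambda>x. c * coord x 0)" for c
    by (rule convex_onI) (use assms in \<open>auto simp: algebra_simps\<close>)
  have sq: "convex_on T (\<lambda>x. (inner v x)\<^sup>2)" for v
  proof (rule convex_onI)
    fix t :: real and x y assume t: "0 < t" "t < 1"
    let ?a = "inner v x" and ?c = "inner v y"
    have "(1 - t) * ?a\<^sup>2 + t * ?c\<^sup>2 - ((1 - t) * ?a + t * ?c)\<^sup>2 = t * (1 - t) * (?a - ?c)\<^sup>2"
      by (simp add: power2_eq_square algebra_simps)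
    also have "\<dots> \<ge> 0" using t by simp
    finally show "(inner v ((1 - t) *\<^sub>R x + t *\<^sub>R y))\<^sup>2 \<le> (1 - t) * (inner v x)\<^sup>2 + t * (inner v y)\<^sup>2"
      by (simp add: inner_add_right)
  qed (use assms in simp)
  have "convex_on T (\<lambda>x. \<Sum>l\<in>S. (inner (edge l) x)\<^sup>2)"
  proof (cases "finite S")
    case True
    then show ?thesis
      by (induction S rule: finite_induct) (simp_all add: convex_on_const convex_on_add sq assms)
  qed (simp add: convex_on_const assms)
  then have "convex_on T (\<lambda>x. \<alpha> * (\<Sum>l\<in>S. (inner (edge l) x)\<^sup>2) + (- b) * coord x 0)"
    using assms by (intro convex_on_add convex_on_cmul lin) auto
  then show ?thesis by (simp add: chain_def[abs_def])
qed

text \<open>The \<open>K\<close> differences sum to \<open>x_0\<close> because \<open>x_K = 0\<close>; by the Cauchy-Schwarz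
inequality their squares sum to at least \<open>x_0^2 / K\<close>.\<close>

lemma chain_ge_on_prefix:
  assumes "x \<in> eucl K" "K \<ge> 1" "\<alpha> \<ge> 0"
  shows "chain \<alpha> b {..<K} x \<ge> \<alpha> * (coord x 0)\<^sup>2 / real K - b * coord x 0"
proof -
  have "(\<Sum>l<K. inner (edge l) x) = coord x 0 - coord x K"
    unfolding inner_edge by (rule sum_lessThan_telescope')
  then have "(coord x 0)\<^sup>2 = (\<Sum>l<K. 1 * inner (edge l) x)\<^sup>2"
    using assms(1) by (simp add: eucl_def)
  also have "\<dots> \<le> (\<Sum>l<K. 1\<^sup>2) * (\<Sum>l<K. (inner (edge l) x)\<^sup>2)"
    by (rule Cauchy_Schwarz_ineq_sum)
  finally have "(coord x 0)\<^sup>2 / real K \<le> (\<Sum>l<K. (inner (edge l) x)\<^sup>2)"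
    using assms(2) by (simp add: field_simps)
  from mult_left_mono[OF this assms(3)] show ?thesis by (simp add: chain_def)
qed

section \<open>The feasible box and the hard instance\<close>

text \<open>The upper bound 0 beyond coordinate \<open>K\<close> confines the box to \<open>eucl (Suc K)\<close> without a
separate condition.\<close>

definition slab :: "nat \<Rightarrow> real \<Rightarrow> real \<Rightarrow> fseq set" where
  "slab K M r = {x. coord x 0 = M \<and>
     (\<forall>l. 0 \<le> coord x (Suc l) \<and> coord x (Suc l) \<le> (if l < K then r else 0))}"

text \<open>The nearest point of the box. The projection operator picks some minimiser of the distance, so a
concrete minimiser is needed to know that it picks one at all.\<close>

lift_definition clip :: "nat \<Rightarrow> real \<Rightarrow> real \<Rightarrow> fseq \<Rightarrow> fseq" is
  "\<lambda>K M r x i. if i = 0 then M else if i \<le> K then max 0 (min r (x i)) else 0"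
  subgoal for K M r x by (rule finite_subset[of _ "{..K}"]) (auto split: if_splits)
  done

lemma coord_clip [simp]: "coord (clip K M r x) i =
    (if i = 0 then M else if i \<le> K then max 0 (min r (coord x i)) else 0)"
  by transfer simp

lift_definition corner :: "nat \<Rightarrow> real \<Rightarrow> real \<Rightarrow> fseq" is
  "\<lambda>K M r i. if i = 0 then M else if i \<le> K then r else 0"
  subgoal for K M r by (rule finite_subset[of _ "{..K}"]) (auto split: if_splits)
  done

lemma coord_corner [simp]:
  "coord (corner K M r) i = (if i = 0 then M else if i \<le> K then r else 0)"
  by transfer simp

lemma slab_subset: "slab K M r \<subseteq> eucl (Suc K)"
proof
  fix x assume x: "x \<in> slab K M r"
  have "coord x i = 0" if "Suc K \<le> i" for i
  proof -
    obtain l where l: "i = Suc l" "\<not> l < K" using \<open>Suc K \<le> i\<close> by (cases i) auto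
    then have "0 \<le> coord x (Suc l)" "coord x (Suc l) \<le> (if l < K then r else 0)"
      using x unfolding slab_def by blast+
    then show ?thesis using l by simp
  qed
  then show "x \<in> eucl (Suc K)" by (simp add: eucl_def)
qed

lemma clip_in_slab: "r \<ge> 0 \<Longrightarrow> clip K M r x \<in> slab K M r"
  by (auto simp: slab_def)

lemma trunc_in_slab:
  assumes "p \<in> slab K M r" "k \<ge> 1" "r \<ge> 0"
  shows "trunc k p \<in> slab K M r"
proof -
  have "0 \<le> coord p (Suc l) \<and> coord p (Suc l) \<le> (if l < K then r else 0)" for l
    using assms(1) unfolding slab_def by blast
  then have "0 \<le> coord (trunc k p) (Suc l) \<and> coord (trunc k p) (Suc l) \<le> (if l < K then r else 0)" for l
    using assms(3) by (cases "Suc l < k") simp_all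
  moreover have "coord (trunc k p) 0 = M" using assms by (simp add: slab_def)
  ultimately show ?thesis unfolding slab_def by blast
qed

lemma is_arg_min_clip:
  assumes "r \<ge> 0"
  shows "is_arg_min (dist x) (\<lambda>u. u \<in> slab K M r) (clip K M r x)"
proof -
  have "dist x (clip K M r x) \<le> dist x z" if "z \<in> slab K M r" for z
    unfolding dist_norm
  proof (rule norm_le_coordwise)
    fix i
    show "\<bar>coord (x - clip K M r x) i\<bar> \<le> \<bar>coord (x - z) i\<bar>"
    proof (cases i)
      case 0
      then show ?thesis using that by (simp add: slab_def)
    next
      case (Suc l)
      then have "0 \<le> coord z i" "coord z i \<le> (if l < K then r else 0)"
        using that by (auto simp: slab_def)
      then show ?thesis using Suc by (auto split: if_splits)
    qed
  qed
  then show ?thesis using clip_in_slab[OF assms] by (force simp: is_arg_min_def)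
qed

text \<open>The box is closed under truncation, so its projection cannot create new coordinates, except
coordinate 0, whence \<open>k \<ge> 1\<close>.\<close>

lemma proj_slab:
  assumes "r \<ge> 0"
  shows "proj (slab K M r) x \<in> slab K M r"
    and "x \<in> eucl k \<Longrightarrow> k \<ge> 1 \<Longrightarrow> proj (slab K M r) x \<in> eucl k"
proof -
  let ?p = "proj (slab K M r) x"
  have m: "is_arg_min (dist x) (\<lambda>u. u \<in> slab K M r) ?p"
    by (rule is_arg_min_proj[OF is_arg_min_clip[OF assms]])
  then show p: "?p \<in> slab K M r" by (simp add: is_arg_min_def)
  assume x: "x \<in> eucl k" "k \<ge> 1"
  show "?p \<in> eucl k"
  proof (rule ccontr)
    assume "?p \<notin> eucl k"
    then have "dist x (trunc k ?p) < dist x ?p"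
      unfolding dist_norm by (rule norm_trunc_less[OF x(1)])
    moreover have "trunc k ?p \<in> slab K M r"
      using p x(2) assms by (rule trunc_in_slab)
    ultimately show False using m by (auto simp: is_arg_min_def)
  qed
qed

lemma continuous_coord: "continuous_on UNIV (\<lambda>x. coord x i)"
proof -
  have "continuous_on UNIV (\<lambda>x. inner (unit_vec i) x)" by (intro continuous_intros)
  then show ?thesis by simp
qed

lemma closed_slab: "closed (slab K M r)"
  unfolding slab_def
  by (intro closed_Collect_conj closed_Collect_all closed_Collect_eq closed_Collect_le
      continuous_coord continuous_on_const)

lemma convex_slab: "convex (slab K M r)"
proof (rule convexI)
  fix x y and u v :: real
  assume *: "x \<in> slab K M r" "y \<in> slab K M r" "0 \<le> u" "0 \<le> v" "u + v = 1"
  have "u * M + v * M = M" using *(5) by (simp flip: distrib_right)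
  moreover have "u * coord x (Suc l) + v * coord y (Suc l) \<le> (if l < K then r else 0)" for l
    using * by (intro convex_bound_le) (auto simp only: slab_def)
  ultimately show "u *\<^sub>R x + v *\<^sub>R y \<in> slab K M r"
    using * by (simp add: slab_def)
qed

lemma slab_norm_diff:
  assumes "x \<in> slab K M r" "y \<in> slab K M r" "r \<ge> 0"
  shows "norm (x - y) \<le> sqrt (real K) * r"
proof -
  have c: "0 \<le> coord z (Suc l) \<and> coord z (Suc l) \<le> (if l < K then r else 0)"
    if "z \<in> slab K M r" for z l
    using that by (auto simp: slab_def)
  have "x - y \<in> eucl (Suc K)"
    using assms slab_subset subspace_diff[OF subspace_eucl] by blast
  then have "(norm (x - y))\<^sup>2 = (\<Sum>i<Suc K. (coord (x - y) i)\<^sup>2)"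
    by (intro norm_sq_superset) (auto simp: eucl_def not_le[symmetric])
  also have "\<dots> = (\<Sum>l<K. (coord x (Suc l) - coord y (Suc l))\<^sup>2)"
    using assms by (subst sum.lessThan_Suc_shift) (simp add: slab_def)
  also have "\<dots> \<le> (\<Sum>l<K. r\<^sup>2)"
  proof (rule sum_mono)
    fix l assume "l \<in> {..<K}"
    then have "\<bar>coord x (Suc l) - coord y (Suc l)\<bar> \<le> \<bar>r\<bar>"
      using c[OF assms(1), of l] c[OF assms(2), of l] by auto
    then show "(coord x (Suc l) - coord y (Suc l))\<^sup>2 \<le> r\<^sup>2" by (simp add: abs_le_square_iff)
  qed
  also have "\<dots> = (sqrt (real K) * r)\<^sup>2" by (simp add: power_mult_distrib)
  finally show ?thesis using assms(3) by (simp add: abs_le_square_iff[symmetric])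
qed

definition owner :: "nat \<Rightarrow> nat \<Rightarrow> nat \<Rightarrow> nat" where
  "owner i0 i1 l = (if even l then i0 else i1)"

text \<open>The linear term is the same in every component, so averaging keeps its slope, whereas each edge
lies in a single component and its weight drops from \<open>L / 4\<close> to \<open>L / (4 n)\<close>.\<close>

definition hard_problem :: "nat \<Rightarrow> nat \<Rightarrow> nat \<Rightarrow> real \<Rightarrow> real \<Rightarrow> real \<Rightarrow> real \<Rightarrow> problem" where
  "hard_problem i0 i1 K L b M r =
     \<lparr>dim = Suc K, feas = slab K M r,
      comp = (\<lambda>i. chain (L / 4) b {l. l < K \<and> owner i0 i1 l = i})\<rparr>"

section \<open>The progress process\<close>

text \<open>The state \<open>k\<close> bounds the number of coordinates reached, and edge \<open>k - 1\<close> is the next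
one to cross. The process starts in state 1 rather than 0: coordinate 0 comes for free, through the
linear term and through the box.\<close>

definition advance :: "nat \<Rightarrow> nat \<Rightarrow> nat \<Rightarrow> nat \<times> bool \<Rightarrow> nat" where
  "advance i0 i1 k s = (if snd s \<or> fst s = owner i0 i1 (k - 1) then Suc k else k)"

definition level :: "nat \<Rightarrow> nat \<Rightarrow> (nat \<times> bool) list \<Rightarrow> nat" where
  "level i0 i1 h = foldl (advance i0 i1) 1 h"

lemma expectation_foldl_le:
  fixes p :: "'a pmf" and step :: "nat \<Rightarrow> 'a \<Rightarrow> nat"
  assumes fin: "finite (set_pmf p)"
    and drift: "\<And>k. measure_pmf.expectation p (\<lambda>s. real (step k s)) \<le> real k + \<pi>"
  shows "measure_pmf.expectation (replicate_pmf t p) (\<lambda>h. real (foldl step k h)) \<le> real k + real t * \<pi>"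
proof (induction t arbitrary: k)
  case 0
  then show ?case by simp
next
  case (Suc t)
  let ?E = "\<lambda>k. measure_pmf.expectation (replicate_pmf t p) (\<lambda>h. real (foldl step k h))"
  have "set_pmf (replicate_pmf t p) = {h. set h \<subseteq> set_pmf p \<and> length h = t}"
    by (auto simp: set_replicate_pmf lists_eq_set)
  then have fin': "finite (set_pmf (replicate_pmf t p))"
    using finite_lists_length_eq[OF fin] by simp
  have "replicate_pmf (Suc t) p = p \<bind> (\<lambda>s. map_pmf ((#) s) (replicate_pmf t p))"
    by (simp add: map_pmf_def)
  then have "measure_pmf.expectation (replicate_pmf (Suc t) p) (\<lambda>h. real (foldl step k h))
      = (\<Sum>s\<in>set_pmf p. pmf p s * ?E (step k s))"
    using fin fin' by (simp add: pmf_expectation_bind[where A = "set_pmf p"])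
  also have "\<dots> \<le> (\<Sum>s\<in>set_pmf p. pmf p s * (real (step k s) + real t * \<pi>))"
    by (intro sum_mono mult_left_mono Suc.IH) simp
  also have "\<dots> = measure_pmf.expectation p (\<lambda>s. real (step k s)) + real t * \<pi>"
  proof -
    have "measure_pmf.expectation p (\<lambda>s. real (step k s)) = (\<Sum>s\<in>set_pmf p. pmf p s * real (step k s))"
      by (subst integral_measure_pmf_real[OF fin]) (auto simp: mult.commute)
    then show ?thesis
      by (simp add: distrib_left sum.distrib sum_pmf_eq_1[OF fin order.refl] flip: sum_distrib_right)
  qed
  also have "\<dots> \<le> real k + real (Suc t) * \<pi>"
    using drift[of k] by (simp add: algebra_simps)
  finally show ?case .
qed

lemma expectation_advance_le:
  assumes "pmf p i0 \<le> \<beta>" "pmf p i1 \<le> \<beta>" "0 \<le> q" "q \<le> 1"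
  shows "measure_pmf.expectation (pair_pmf p (bernoulli_pmf q)) (\<lambda>s. real (advance i0 i1 k s))
    \<le> real k + (\<beta> + q)"
proof -
  let ?p = "pair_pmf p (bernoulli_pmf q)" and ?o = "owner i0 i1 (k - 1)"
  let ?A = "{s. fst s = ?o}" and ?B = "{s. snd s}"
  have A: "measure ?p ?A = pmf p ?o"
    using measure_map_pmf[of fst ?p "{?o}"]
    by (simp add: map_fst_pair_pmf measure_pmf_single vimage_def)
  have B: "measure ?p ?B = q"
    using measure_map_pmf[of snd ?p "{True}"] assms
    by (simp add: map_snd_pair_pmf measure_pmf_single vimage_def)
  have "measure_pmf.expectation ?p (\<lambda>s. real (advance i0 i1 k s))
      = measure_pmf.expectation ?p (\<lambda>s. real k + indicator (?A \<union> ?B) s)"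
    by (intro Bochner_Integration.integral_cong) (auto simp: advance_def indicator_def)
  also have "\<dots> = real k + measure ?p (?A \<union> ?B)"
    by (subst Bochner_Integration.integral_add) (auto simp: measure_pmf.emeasure_eq_measure)
  also have "measure ?p (?A \<union> ?B) \<le> measure ?p ?A + measure ?p ?B"
    by (rule measure_Un_le) auto
  also have "\<dots> \<le> \<beta> + q" using A B assms by (simp add: owner_def)
  finally show ?thesis by simp
qed

text \<open>The probabilities sum to at most 1, so fewer than \<open>n / 2\<close> of them exceed \<open>2 / n\<close>.\<close>

lemma exists_two_light_indices:
  fixes p :: "nat pmf"
  assumes "n \<ge> 2"
  obtains i0 i1 where "i0 \<in> {1..n}" "i1 \<in> {1..n}" "i0 \<noteq> i1" "pmf p i0 \<le> 2 / real n" "pmf p i1 \<le> 2 / real n"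
proof -
  define H where "H = {i \<in> {1..n}. pmf p i > 2 / real n}"
  have H: "finite H" "H \<subseteq> {1..n}" by (auto simp: H_def)
  have "real (card H) * 2 < real n \<or> card H = 0"
  proof (cases "H = {}")
    case False
    have "real (card H) * (2 / real n) = (\<Sum>i\<in>H. 2 / real n)" by simp
    also have "\<dots> < (\<Sum>i\<in>H. pmf p i)"
      by (rule sum_strict_mono) (use False H in \<open>auto simp: H_def\<close>)
    also have "\<dots> = measure p H" using H by (simp add: measure_measure_pmf_finite)
    also have "\<dots> \<le> 1" by simp
    finally show ?thesis using assms by (simp add: field_simps)
  next
    case True
    then show ?thesis by simp
  qed
  moreover have "card ({1..n} - H) = n - card H"
    using H by (subst card_Diff_subset) auto
  ultimately have "card ({1..n} - H) \<ge> 2" using assms by auto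
  then obtain i0 i1 where "{i0, i1} \<subseteq> {1..n} - H" "i0 \<noteq> i1"
    by (metis card_2_iff obtain_subset_with_card_n)
  then show ?thesis by (intro that[of i0 i1]) (auto simp: H_def)
qed


section \<open>The hard instance confines the iterates\<close>

locale hard_instance =
  fixes n i0 i1 K :: nat and L b M r :: real
  assumes i01: "i0 \<in> {1..n}" "i1 \<in> {1..n}" "i0 \<noteq> i1"
    and K1: "K \<ge> 1" and L0: "L > 0" and r0: "r \<ge> 0"
begin

abbreviation "P \<equiv> hard_problem i0 i1 K L b M r"
abbreviation "E i \<equiv> {l. l < K \<and> owner i0 i1 l = i}"

lemma owner_in: "owner i0 i1 l \<in> {1..n}"
  using i01 by (simp add: owner_def)

lemma owner_Suc: "owner i0 i1 (Suc l) \<noteq> owner i0 i1 l"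
  using i01 by (simp add: owner_def)

lemma n0: "n > 0" using i01 by auto

lemma objective_P: "objective n P = chain (L / (4 * real n)) b {..<K}"
proof
  fix x
  let ?g = "\<lambda>l. (inner (edge l) x)\<^sup>2"
  have grp: "(\<Sum>i = 1..n. sum ?g {l \<in> {..<K}. owner i0 i1 l = i}) = sum ?g {..<K}"
    by (rule sum.group) (use owner_in in auto)
  have "comp P i x = L / 4 * sum ?g {l \<in> {..<K}. owner i0 i1 l = i} - b * coord x 0" for i
    by (simp add: hard_problem_def chain_def)
  then have "(\<Sum>i = 1..n. comp P i x) = L / 4 * sum ?g {..<K} - real n * (b * coord x 0)"
    by (simp only: sum_subtractf sum_distrib_left[symmetric] grp) simp
  then show "objective n P x = chain (L / (4 * real n)) b {..<K} x"
    using n0 by (simp add: objective_def chain_def field_simps)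
qed

lemma smooth_comp: "smooth (dim P) L (comp P i)"
  unfolding hard_problem_def using owner_Suc L0 by (auto intro!: smooth_chain)

lemma smooth_problem_P: "smooth_problem n P"
proof -
  have P: "dim P = Suc K" "feas P = slab K M r" by (simp_all add: hard_problem_def)
  have "slab K M r \<noteq> {}" using clip_in_slab[OF r0] by blast
  moreover have "\<exists>L'. smooth (Suc K) L' (comp P i)" for i using smooth_comp P(1) by metis
  ultimately show ?thesis
    using slab_subset closed_slab convex_slab by (simp add: smooth_problem_def P)
qed

lemma P_in_class:
  assumes "sqrt (real K) * r \<le> 2 * R"
  shows "P \<in> problem_class n R L 0"
proof -
  have d: "norm (x - y) \<le> 2 * R" if "x \<in> feas P" "y \<in> feas P" for x y
    using slab_norm_diff[OF _ _ r0, of x K M y] that assms by (simp add: hard_problem_def)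
  have "clip K M r 0 \<in> feas P" using clip_in_slab[OF r0] by (simp add: hard_problem_def)
  then have "bounded (feas P)" unfolding bounded_def dist_norm using d by blast
  moreover have "diameter (feas P) \<le> 2 * R"
    by (rule diameter_le) (use d \<open>clip K M r 0 \<in> feas P\<close> in auto)
  moreover have "strongly_convex (dim P) 0 (objective n P)"
    unfolding strongly_convex_def objective_P using L0
    by (simp add: convex_chain subspace_imp_convex subspace_eucl)
  ultimately show ?thesis
    using smooth_problem_P smooth_comp by (simp add: problem_class_def)
qed

text \<open>Two incident edges have different owners. A component that owns edge \<open>k - 1\<close> therefore
lacks edge \<open>k\<close>, and the next lemma applies to it with \<open>k + 1\<close> in place of \<open>k\<close>: one
query gains at most one coordinate.\<close>

lemma grad_prox_comp_in_eucl:
  assumes "x \<in> eucl k" "x \<in> eucl (dim P)" "k \<ge> 1" "\<gamma> > 0" "i \<noteq> owner i0 i1 (k - 1)"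
  shows "grad (dim P) (comp P i) x \<in> eucl k"
    and "p \<in> prox (dim P) \<gamma> (comp P i) x \<Longrightarrow> p \<in> eucl k"
proof -
  have k: "k - 1 \<notin> E i" using assms by auto
  have sub: "E i \<subseteq> {..<K}" by auto
  show "grad (dim P) (comp P i) x \<in> eucl k"
    using assms(2) chain_grad_in_eucl[OF assms(1,3) k] by (simp add: hard_problem_def grad_chain[OF sub])
  assume "p \<in> prox (dim P) \<gamma> (comp P i) x"
  then show "p \<in> eucl k"
    by (rule prox_in_eucl[OF assms(4,1)])
      (use chain_trunc_le[OF assms(3) k] L0 in \<open>simp add: hard_problem_def\<close>)
qed

lemma grad_objective_in_eucl:
  assumes "x \<in> eucl k" "x \<in> eucl (dim P)"
  shows "grad (dim P) (objective n P) x \<in> eucl (Suc k)"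
proof -
  have e: "(2 * a * inner (edge l) x) *\<^sub>R edge l \<in> eucl (Suc k)" for a l
  proof (cases "Suc l < Suc k")
    case True
    then show ?thesis by (intro subspace_scale[OF subspace_eucl] edge_in_eucl)
  next
    case False
    then show ?thesis using assms(1) by (simp add: inner_edge eucl_def)
  qed
  have "b *\<^sub>R unit_vec 0 \<in> eucl (Suc k)" by (auto simp: eucl_def)
  then have "chain_grad (L / (4 * real n)) b {..<K} x \<in> eucl (Suc k)"
    unfolding chain_grad_def by (intro subspace_diff subspace_sum subspace_eucl e)
  then show ?thesis
    using assms(2) unfolding objective_P by (simp add: hard_problem_def grad_chain)
qed

abbreviation "lev \<equiv> level i0 i1"

lemma lev_take_Suc: "j < length h \<Longrightarrow> lev (take (Suc j) h) = advance i0 i1 (lev (take j h)) (h ! j)"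
  by (simp add: level_def take_Suc_conv_app_nth)

lemma advance_ge: "k \<le> advance i0 i1 k s" by (simp add: advance_def)

lemma lev_take_mono:
  assumes "l \<le> j" "j \<le> length h"
  shows "lev (take l h) \<le> lev (take j h)"
  using assms
proof (induction j rule: dec_induct)
  case (step m)
  then show ?case using lev_take_Suc[of m h] advance_ge[of "lev (take m h)" "h ! m"] by simp
qed simp

lemma lev_ge_1: "lev h \<ge> 1"
  using lev_take_mono[of 0 "length h" h] by (simp add: level_def)

text \<open>A component query of step \<open>j\<close> may refer to any earlier point \<open>x_l\<close>, whose level may lie
below that of step \<open>j - 1\<close>. If the owner of the next edge of \<open>x_l\<close> is sampled, either the
level was still the one of \<open>x_l\<close> and rises now, or it had risen before.\<close>

lemma lev_advanced:
  assumes "l < j" "j \<le> length h" "snd (h ! (j - 1)) \<and> l = j - 1 \<or> fst (h ! (j - 1)) = owner i0 i1 (lev (take l h) - 1)"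
  shows "Suc (lev (take l h)) \<le> lev (take j h)"
proof -
  obtain m where m: "j = Suc m" using assms(1) by (cases j) auto
  have "lev (take l h) \<le> lev (take m h)" using assms m by (intro lev_take_mono) auto
  moreover have "lev (take j h) = advance i0 i1 (lev (take m h)) (h ! m)"
    using assms m by (simp add: lev_take_Suc)
  ultimately show ?thesis
    using assms(3) m by (cases "lev (take l h) = lev (take m h)") (auto simp: advance_def)
qed

lemma iterate_in_eucl_dim: "iterate A P \<omega> h \<in> eucl (dim P)"
proof (cases "h = []")
  case False
  then have "iterate A P \<omega> h \<in> slab K M r"
    using proj_slab(1)[OF r0] by (simp add: iterate_def hard_problem_def)
  then show ?thesis using slab_subset by (auto simp: hard_problem_def)
qed (simp add: iterate_def eucl_def)

text \<open>The generators of the span available after \<open>h\<close> all lie in \<open>eucl (lev h)\<close>: earlier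
points by induction, component queries and full gradients because the history advances whenever they
would leave the level of the queried point. The full gradient at the starting point is available
without any draw, but involves coordinate 0 only. Projection keeps the subspace.\<close>

lemma iterate_in_eucl_level:
  assumes A: "pifo_algorithm c0 n A" and h: "set h \<subseteq> {1..n} \<times> UNIV"
  shows "iterate A P \<omega> h \<in> eucl (lev h)"
  using h
proof (induction "length h" arbitrary: h rule: less_induct)
  case less
  let ?x = "\<lambda>l. iterate A P \<omega> (take l h)" and ?k = "\<lambda>l. lev (take l h)"
  let ?F = "\<lambda>j. comp P (fst (h ! (j - 1)))"
  have valid: "set (take j h) \<subseteq> {1..n} \<times> UNIV" for j
    using set_take_subset[of j h] less.prems by blast
  have IH: "?x l \<in> eucl (?k l)" if "l < length h" for l
    using less.hyps[of "take l h"] that valid by simp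
  have lift: "y \<in> eucl (lev h)" if "y \<in> eucl (?k j)" "j \<le> length h" for y j
    using eucl_mono[OF lev_take_mono[of j "length h" h]] that by auto
  show ?case
  proof (cases "h = []")
    case True
    then show ?thesis by (simp add: iterate_def eucl_def)
  next
    case False
    have gamma: "stepsize A P \<omega> (take j h) > 0" if "0 < j" "j \<le> length h" for j
    proof -
      have "take j h \<noteq> []" using that False by auto
      then show ?thesis
        using A smooth_problem_P valid[of j] by (auto simp: pifo_algorithm_def prox_admissible_def)
    qed
    have comp: "grad (dim P) (?F j) (?x l) \<in> eucl (lev h)"
      "p \<in> prox (dim P) (stepsize A P \<omega> (take j h)) (?F j) (?x l) \<Longrightarrow> p \<in> eucl (lev h)"
      if lj: "l < j" "j \<le> length h" for l j p
    proof -
      let ?i = "fst (h ! (j - 1))"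
      have xl: "?x l \<in> eucl (?k l)" using IH lj by simp
      \<comment> \<open>the first level from that of \<open>x_l\<close> on at which component \<open>?i\<close> splits\<close>
      define k where "k = (if ?i = owner i0 i1 (?k l - 1) then Suc (?k l) else ?k l)"
      have k: "?x l \<in> eucl k" "k \<ge> 1" "?i \<noteq> owner i0 i1 (k - 1)"
        using xl lev_ge_1[of "take l h"] eucl_mono[of "?k l" "Suc (?k l)"]
          owner_Suc[of "?k l - 1"] by (auto simp: k_def)
      have "k \<le> ?k j"
        using lev_advanced[OF lj] lev_take_mono[of l j h] lj by (auto simp: k_def)
      then have up: "y \<in> eucl k \<Longrightarrow> y \<in> eucl (lev h)" for y
        using eucl_mono[of k "?k j"] lift[OF _ lj(2)] by blast
      note g = grad_prox_comp_in_eucl[OF k(1) iterate_in_eucl_dim k(2) gamma k(3)]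
      show "grad (dim P) (?F j) (?x l) \<in> eucl (lev h)"
        "p \<in> prox (dim P) (stepsize A P \<omega> (take j h)) (?F j) (?x l) \<Longrightarrow> p \<in> eucl (lev h)"
        using g(1)[of j] g(2)[of j p] lj by (auto intro: up)
    qed
    have full: "grad (dim P) (objective n P) u \<in> eucl (lev h)" if "u \<in> full_queries A P \<omega> h" for u
      using that unfolding full_queries_def
    proof (elim insertE CollectE exE conjE)
      assume "u = iterate A P \<omega> []"
      then have "grad (dim P) (objective n P) u \<in> eucl (Suc 0)"
        by (intro grad_objective_in_eucl) (auto simp: iterate_def eucl_def)
      then show ?thesis using eucl_mono[of "Suc 0" "lev h"] lev_ge_1[of h] by auto
    next
      fix j assume j: "u = iterate A P \<omega> (take (j - 1) h)" "j \<in> {1..length h}" "snd (h ! (j - 1))"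
      then have "grad (dim P) (objective n P) u \<in> eucl (Suc (?k (j - 1)))"
        unfolding j(1) by (intro grad_objective_in_eucl iterate_in_eucl_dim IH) auto
      moreover have "Suc (?k (j - 1)) \<le> ?k j"
        using j by (intro lev_advanced) auto
      ultimately show ?thesis using lift[of _ j] eucl_mono j(2) by auto
    qed
    have "pifo_span n A P \<omega> h \<subseteq> eucl (lev h)"
      unfolding pifo_span_def Let_def
    proof (rule span_minimal[OF _ subspace_eucl], intro Un_least subsetI)
      fix y assume "y \<in> {?x l | l. l < length h}"
      then show "y \<in> eucl (lev h)" using IH lift by fastforce
    qed (use comp full in auto)
    moreover have "choice A P \<omega> h \<in> pifo_span n A P \<omega> h"
      using A smooth_problem_P False less.prems by (auto simp: pifo_algorithm_def)
    ultimately have "proj (slab K M r) (choice A P \<omega> h) \<in> eucl (lev h)"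
      using proj_slab(2)[OF r0 _ lev_ge_1] by blast
    then show ?thesis using False by (simp add: iterate_def hard_problem_def)
  qed
qed


section \<open>The expected suboptimality\<close>

text \<open>At this point only the first edge is stretched.\<close>

lemma objective_corner: "objective n P (corner K M r) = L / (4 * real n) * (M - r)\<^sup>2 - b * M"
proof -
  have "(\<Sum>l<K. (inner (edge l) (corner K M r))\<^sup>2) = (\<Sum>l<K. if l = 0 then (M - r)\<^sup>2 else 0)"
    using K1 by (intro sum.cong) (auto simp: inner_edge)
  also have "\<dots> = (M - r)\<^sup>2" using K1 by simp
  finally show ?thesis by (simp add: objective_P chain_def)
qed

abbreviation "opt \<equiv> (INF x\<in>feas P. objective n P x)"

lemma opt_le: "x \<in> feas P \<Longrightarrow> opt \<le> objective n P x"
proof (rule cINF_lower)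
  have "- b * M \<le> objective n P x" if "x \<in> feas P" for x
  proof -
    have "coord x 0 = M" using that by (simp add: hard_problem_def slab_def)
    then show ?thesis unfolding objective_P using L0 by (simp add: chain_def sum_nonneg)
  qed
  then show "bdd_below (objective n P ` feas P)" by (rule bdd_belowI2)
qed

lemma opt_le_corner: "opt \<le> L / (4 * real n) * (M - r)\<^sup>2 - b * M"
  using opt_le[of "corner K M r"] r0 unfolding objective_corner
  by (simp add: hard_problem_def slab_def)

text \<open>A pathwise form of Markov's inequality, affine in the level so that expectations can be taken
directly: below level \<open>K + 1\<close> the objective is nonnegative, above it the factor of the
nonpositive \<open>opt\<close> is at least 1. With this \<open>b\<close> the bound of \<open>chain_ge_on_prefix\<close> vanishes at
\<open>x_0 = M\<close> as well as at \<open>x_0 = 0\<close>, which covers the points of the box and the starting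
point.\<close>

lemma objective_iterate_ge:
  assumes b: "b = L / (4 * real n) * M / real K" and opt: "opt \<le> 0"
    and A: "pifo_algorithm c0 n A" and h: "set h \<subseteq> {1..n} \<times> UNIV"
  shows "opt * ((real (lev h) - 1) / real K) \<le> objective n P (iterate A P \<omega> h)"
proof (cases "lev h \<le> K")
  case True
  let ?x = "iterate A P \<omega> h"
  have x: "?x \<in> eucl K"
    using iterate_in_eucl_level[OF A h] eucl_mono[OF True] by blast
  have x0: "coord ?x 0 = 0 \<or> coord ?x 0 = M"
    using proj_slab(1)[OF r0, of K M] by (auto simp: iterate_def hard_problem_def slab_def)
  have "opt * ((real (lev h) - 1) / real K) \<le> 0"
    using opt lev_ge_1[of h] by (intro mult_nonpos_nonneg divide_nonneg_nonneg) auto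
  also have "0 = L / (4 * real n) * (coord ?x 0)\<^sup>2 / real K - b * coord ?x 0"
    using x0 by (auto simp: b power2_eq_square)
  also have "\<dots> \<le> objective n P ?x"
    unfolding objective_P using L0 K1 x by (intro chain_ge_on_prefix) auto
  finally show ?thesis .
next
  case False
  then have "h \<noteq> []" using K1 by (auto simp: level_def)
  then have "iterate A P \<omega> h \<in> feas P"
    using proj_slab(1)[OF r0] by (simp add: iterate_def hard_problem_def)
  then have "opt \<le> objective n P (iterate A P \<omega> h)" by (rule opt_le)
  moreover have "(real (lev h) - 1) / real K \<ge> 1" using False K1 by simp
  ultimately show ?thesis using mult_left_mono_neg[OF _ opt] by fastforce
qed

text \<open>The bound holds for every value of the seed, so it survives averaging over the seed. If the
average is not integrable, its integral is 0 by convention, which respects the bound because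
\<open>opt \<le> 0\<close>.\<close>

lemma expected_value_ge:
  assumes b: "b = L / (4 * real n) * M / real K" and opt: "opt \<le> 0"
    and A: "pifo_algorithm c0 n A"
    and light: "pmf (sampling A) i0 \<le> 2 / real n" "pmf (sampling A) i1 \<le> 2 / real n"
    and T: "real T * (2 + c0) \<le> real n * real K / 2"
  shows "opt / 2 \<le> expected_value n A P T"
proof -
  let ?p = "pair_pmf (sampling A) (bernoulli_pmf (full_prob A))"
  let ?\<pi> = "2 / real n + full_prob A"
  let ?H = "history_pmf A T"
  have A': "set_pmf (sampling A) \<subseteq> {1..n}" "0 < full_prob A" "full_prob A \<le> c0 / real n"
    "full_prob A \<le> 1" "prob_space (seed A)"
    using A by (auto simp: pifo_algorithm_def)
  have fin: "finite (set_pmf ?p)"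
    using finite_subset[OF A'(1)] by simp
  have H: "set_pmf ?H = {h. set h \<subseteq> set_pmf ?p \<and> length h = T}"
    by (auto simp: history_pmf_def set_replicate_pmf lists_eq_set)
  then have finH: "finite (set_pmf ?H)" using finite_lists_length_eq[OF fin] by simp
  have int: "integrable (measure_pmf ?H) f" for f :: "_ \<Rightarrow> real"
    by (rule integrable_measure_pmf_finite[OF finH])
  have lev: "measure_pmf.expectation ?H (\<lambda>h. real (lev h)) \<le> real 1 + real T * ?\<pi>"
    unfolding level_def history_pmf_def using A' light
    by (intro expectation_foldl_le fin expectation_advance_le) auto
  have "real T * ?\<pi> \<le> real T * ((2 + c0) / real n)"
    using A' by (intro mult_left_mono) (auto simp: add_divide_distrib)
  also have "\<dots> \<le> real K / 2" using T n0 by (simp add: field_simps)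
  finally have "real T * ?\<pi> \<le> real K / 2" .
  with lev have "measure_pmf.expectation ?H (\<lambda>h. real (lev h)) - 1 \<le> real K / 2" by linarith
  then have lev': "(measure_pmf.expectation ?H (\<lambda>h. real (lev h)) - 1) / real K \<le> 1 / 2"
    using K1 by (simp add: divide_le_eq)
  have E: "opt / 2 \<le> measure_pmf.expectation ?H (\<lambda>h. objective n P (iterate A P \<omega> h))" for \<omega>
  proof -
    have "opt / 2 \<le> opt * ((measure_pmf.expectation ?H (\<lambda>h. real (lev h)) - 1) / real K)"
      using mult_left_mono_neg[OF lev' opt] by simp
    also have "\<dots> = measure_pmf.expectation ?H (\<lambda>h. opt * ((real (lev h) - 1) / real K))"
      using int by simp
    also have "\<dots> \<le> measure_pmf.expectation ?H (\<lambda>h. objective n P (iterate A P \<omega> h))"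
    proof (intro integral_mono_AE int AE_pmfI)
      fix h assume "h \<in> set_pmf ?H"
      then have "set h \<subseteq> {1..n} \<times> UNIV" using H A'(1) by auto
      then show "opt * ((real (lev h) - 1) / real K) \<le> objective n P (iterate A P \<omega> h)"
        by (rule objective_iterate_ge[OF b opt A])
    qed
    finally show ?thesis .
  qed
  interpret seed: prob_space "seed A" by (rule A')
  show ?thesis
  proof (cases "integrable (seed A) (\<lambda>\<omega>. measure_pmf.expectation ?H (\<lambda>h. objective n P (iterate A P \<omega> h)))")
    case True
    have "opt / 2 = (\<integral>\<omega>. opt / 2 \<partial>seed A)" by (simp add: seed.prob_space)
    also have "\<dots> \<le> expected_value n A P T"
      unfolding expected_value_def by (intro integral_mono E True) simp
    finally show ?thesis .
  next
    case False
    then show ?thesis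
      using opt by (simp add: expected_value_def not_integrable_integral_eq)
  qed
qed

end

section \<open>The minimax bound\<close>

lemma minimax_complexity_ge:
  fixes n K B :: nat and M r c0 L R \<epsilon> :: real
  assumes "n \<ge> 2" "K \<ge> 1" "L > 0" "R > 0" "\<epsilon> > 0"
    and r: "r = 2 * R / sqrt (real K)"
    and gap: "2 * \<epsilon> \<le> L / (4 * real n) * (M\<^sup>2 / real K - (M - r)\<^sup>2)"
    and B: "\<And>T. T < B \<Longrightarrow> real T * (2 + c0) \<le> real n * real K / 2"
  shows "enat B \<le> minimax_complexity c0 n \<epsilon> R L 0"
  unfolding minimax_complexity_def
proof (rule INF_greatest)
  fix A assume "A \<in> {A. pifo_algorithm c0 n A}"
  then have A: "pifo_algorithm c0 n A" by simp
  obtain i0 i1 where i: "i0 \<in> {1..n}" "i1 \<in> {1..n}" "i0 \<noteq> i1"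
    "pmf (sampling A) i0 \<le> 2 / real n" "pmf (sampling A) i1 \<le> 2 / real n"
    using exists_two_light_indices[OF \<open>n \<ge> 2\<close>] by metis
  define b where "b = L / (4 * real n) * M / real K"
  have r0: "r \<ge> 0" using assms by simp
  interpret hard_instance n i0 i1 K L b M r
    by standard (use i assms r0 in auto)
  have opt: "opt \<le> - (2 * \<epsilon>)"
    using opt_le_corner gap by (simp add: b_def power2_eq_square algebra_simps)
  have "enat B \<le> complexity n A P \<epsilon>"
    unfolding complexity_def
  proof (rule Inf_greatest, clarify)
    fix T assume T: "expected_value n A P T - opt < \<epsilon>"
    have "B \<le> T"
    proof (rule ccontr)
      assume "\<not> B \<le> T"
      then have "opt / 2 \<le> expected_value n A P T"
        using opt \<open>\<epsilon> > 0\<close> by (intro expected_value_ge[OF b_def _ A i(4,5)] B) auto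
      then show False using T opt by simp
    qed
    then show "enat B \<le> enat T" by simp
  qed
  also have "\<dots> \<le> (SUP I\<in>problem_class n R L 0. complexity n A I \<epsilon>)"
    using assms by (intro SUP_upper P_in_class) (simp add: r)
  finally show "enat B \<le> (SUP I\<in>problem_class n R L 0. complexity n A I \<epsilon>)" .
qed

lemma minimax_complexity_ge_real:
  assumes "n \<ge> 2" "K \<ge> 1" "L > 0" "R > 0" "\<epsilon> > 0" "c0 > 0"
    and "r = 2 * R / sqrt (real K)"
    and "2 * \<epsilon> \<le> L / (4 * real n) * (M\<^sup>2 / real K - (M - r)\<^sup>2)"
  shows "ereal (real n * real K / (2 * (2 + c0))) \<le> ereal_of_enat (minimax_complexity c0 n \<epsilon> R L 0)"
proof -
  define z where "z = real n * real K / (2 * (2 + c0))"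
  define B where "B = nat \<lceil>z\<rceil>"
  have "real T * (2 + c0) \<le> real n * real K / 2" if "T < B" for T
  proof -
    have "real T \<le> z" using that unfolding B_def by linarith
    then show ?thesis using assms(6) by (simp add: z_def field_simps)
  qed
  from minimax_complexity_ge[OF assms(1-5,7,8) this]
  have "ereal_of_enat (enat B) \<le> ereal_of_enat (minimax_complexity c0 n \<epsilon> R L 0)"
    by (simp only: ereal_of_enat_le_iff)
  moreover have "z \<le> real B" unfolding B_def by linarith
  ultimately have "ereal z \<le> ereal_of_enat (minimax_complexity c0 n \<epsilon> R L 0)"
    by (metis ereal_less_eq(3) ereal_of_enat_simps(1) order_trans)
  then show ?thesis by (simp only: z_def)
qed

theorem theoremE7:
  fixes c0 :: real
  assumes "c0 > 0"
  shows "\<exists>c>0. \<forall>(n::nat) (L::real) (R::real) (\<epsilon>::real).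
           n \<ge> 2 \<and> L > 0 \<and> R > 0 \<and> \<epsilon> > 0 \<and> \<epsilon> \<le> L * R\<^sup>2 / 4 \<longrightarrow>
           ereal (c * (real n + R * sqrt (real n * L / \<epsilon>)))
             \<le> ereal_of_enat (minimax_complexity c0 n \<epsilon> R L 0)"
proof (intro exI[of _ "1 / (8 * (2 + c0))"] conjI allI impI)
  show "1 / (8 * (2 + c0)) > 0" using assms by simp
  fix n :: nat and L R \<epsilon> :: real
  assume "n \<ge> 2 \<and> L > 0 \<and> R > 0 \<and> \<epsilon> > 0 \<and> \<epsilon> \<le> L * R\<^sup>2 / 4"
  then have n: "n \<ge> 2" and L: "L > 0" and R: "R > 0" and e: "\<epsilon> > 0" by auto
  \<comment> \<open>the largest real \<open>K\<close> for which the gap \<open>L R^2 / (n K^2)\<close> is still at least \<open>2 \<epsilon>\<close>\<close>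
  define z where "z = R * sqrt (L / (2 * real n * \<epsilon>))"
  define K where "K = max 1 (nat \<lfloor>z\<rfloor>)"
  define r where "r = 2 * R / sqrt (real K)"
  have z0: "z \<ge> 0" using L R e by (simp add: z_def)
  have K: "K \<ge> 1" by (simp add: K_def)
  have "\<exists>M. 2 * \<epsilon> \<le> L / (4 * real n) * (M\<^sup>2 / real K - (M - r)\<^sup>2)"
  proof (cases "z < 1")
    case True
    then have "K = 1" using z0 by (simp add: K_def)
    then have r2: "r = 2 * R" by (simp add: r_def)
    \<comment> \<open>solves \<open>L / (4 n) (M^2 - (M - 2 R)^2) = 2 \<epsilon>\<close>\<close>
    define M where "M = R + 2 * real n * \<epsilon> / (L * R)"
    have "M\<^sup>2 - (M - r)\<^sup>2 = 4 * R * (M - R)"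
      unfolding r2 by (simp add: power2_eq_square algebra_simps)
    also have "\<dots> = 8 * real n * \<epsilon> / L" using L R by (simp add: M_def)
    finally have "2 * \<epsilon> \<le> L / (4 * real n) * (M\<^sup>2 / real K - (M - r)\<^sup>2)"
      using n L \<open>K = 1\<close> by simp
    then show ?thesis by (rule exI[of _ M])
  next
    case False
    moreover have "real (nat \<lfloor>z\<rfloor>) \<le> z" using z0 by linarith
    ultimately have "real K \<le> z" unfolding K_def of_nat_max by simp
    then have "(real K)\<^sup>2 \<le> z\<^sup>2" by (simp add: power_mono)
    also have "z\<^sup>2 = R\<^sup>2 * L / (2 * real n * \<epsilon>)"
      using L e by (simp add: z_def power_mult_distrib)
    finally have "2 * \<epsilon> \<le> L / (4 * real n) * (4 * R\<^sup>2 / (real K)\<^sup>2)"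
      using n e K by (simp add: field_simps)
    also have "4 * R\<^sup>2 / (real K)\<^sup>2 = r\<^sup>2 / real K"
      by (simp add: r_def power_divide power_mult_distrib power2_eq_square)
    also have "L / (4 * real n) * (r\<^sup>2 / real K)
        \<le> L / (4 * real n) * ((r * (1 + 1 / real K))\<^sup>2 / real K - (r * (1 + 1 / real K) - r)\<^sup>2)"
    proof -
      have "(r * (1 + 1 / real K))\<^sup>2 / real K - (r * (1 + 1 / real K) - r)\<^sup>2 - r\<^sup>2 / real K
          = r\<^sup>2 * (real K + 1) / (real K)^3"
        using K by (simp add: power2_eq_square power3_eq_cube field_simps)
      also have "\<dots> \<ge> 0" by simp
      finally have "r\<^sup>2 / real K \<le> (r * (1 + 1 / real K))\<^sup>2 / real K - (r * (1 + 1 / real K) - r)\<^sup>2"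
        by linarith
      then show ?thesis by (rule mult_left_mono) (use L in simp)
    qed
    finally show ?thesis by (rule exI[of _ "r * (1 + 1 / real K)"])
  qed
  then obtain M where M: "2 * \<epsilon> \<le> L / (4 * real n) * (M\<^sup>2 / real K - (M - r)\<^sup>2)" by blast
  have "R * sqrt (real n * L / \<epsilon>) = sqrt 2 * real n * z"
  proof -
    have "real n * L / \<epsilon> = 2 * (real n)\<^sup>2 * (L / (2 * real n * \<epsilon>))"
      using n by (simp add: power2_eq_square)
    then have "sqrt (real n * L / \<epsilon>) = sqrt 2 * real n * sqrt (L / (2 * real n * \<epsilon>))"
      by (simp only: real_sqrt_mult real_sqrt_abs abs_of_nat)
    then show ?thesis unfolding z_def by (simp only: mult_ac)
  qed
  also have "\<dots> \<le> 3 / 2 * real n * (2 * real K)"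
  proof (intro mult_mono)
    show "sqrt 2 \<le> 3 / 2" by (rule real_le_lsqrt) (auto simp: power2_eq_square)
    show "z \<le> 2 * real K" using z0 unfolding K_def by linarith
  qed (use z0 in auto)
  also have "\<dots> = 3 * (real n * real K)" by simp
  finally have "R * sqrt (real n * L / \<epsilon>) \<le> 3 * (real n * real K)" .
  moreover have "real n * 1 \<le> real n * real K" using K by (intro mult_left_mono) auto
  ultimately have "real n + R * sqrt (real n * L / \<epsilon>) \<le> 4 * (real n * real K)" by linarith
  then have "1 / (8 * (2 + c0)) * (real n + R * sqrt (real n * L / \<epsilon>))
      \<le> 1 / (8 * (2 + c0)) * (4 * (real n * real K))"
    using assms by (intro mult_left_mono) auto
  also have "\<dots> = real n * real K / (2 * (2 + c0))" using assms by (simp add: field_simps)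
  finally have "ereal (1 / (8 * (2 + c0)) * (real n + R * sqrt (real n * L / \<epsilon>)))
      \<le> ereal (real n * real K / (2 * (2 + c0)))"
    by (simp only: ereal_less_eq)
  also note minimax_complexity_ge_real[OF n K L R e assms r_def M]
  finally show "ereal (1 / (8 * (2 + c0)) * (real n + R * sqrt (real n * L / \<epsilon>)))
      \<le> ereal_of_enat (minimax_complexity c0 n \<epsilon> R L 0)" .
qed

end
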